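(* Let $n\ge 1$ and $s\in\{0,1,\ldots,n-1\}$. Let $\mathcal{F}\subset C^2(\mathbb{R}^n,\mathbb{R})$ denote the subset of objective functions $f$ for which each M-stationary point of the problem SCNO of minimizing $f$ over $\mathbb{R}^{n,s}$ is nondegenerate. Then $\mathcal{F}$ is $C^2_s$-open and $C^2_s$-dense in $C^2(\mathbb{R}^n,\mathbb{R})$.
   Context: For $x\in\mathbb{R}^n$, $\|x\|_0$ is the number of non-zero entries of $x$, and $\mathbb{R}^{n,s}=\{x\in\mathbb{R}^n : \|x\|_0\le s\}$. SCNO is the problem $\min f(x)$ s.t. $x\in\mathbb{R}^{n,s}$. For $x\in\mathbb{R}^{n,s}$ put $I_0(x)=\{i: x_i=0\}$ and $I_1(x)=\{i: x_i\neq 0\}$. A point $\bar x\in\mathbb{R}^{n,s}$ is M-stationary if $\frac{\partial f}{\partial x_i}(\bar x)=0$ for all $i\in I_1(\bar x)$. An M-stationary point $\bar x$ with $\|\bar x\|_0=k$ is nondegenerate if: (ND1) if $k<s$ then $\frac{\partial f}{\partial x_i}(\bar x)\ne0$ for all $i\in I_0(\bar x)$; and (ND2) the matrix $\left(\frac{\partial^2 f}{\partial x_i\partial x_j}(\bar x)\right)_{i,j\in I_1(\bar x)}$ is nonsingular. The $C^2_s$-topology is the strong (Whitney) $C^2$-topology on $C^2(\mathbb{R}^n,\mathbb{R})$: a neighborhood base of $f$ consists of the sets of all $g$ such that the function value, all first-order and all second-order partial derivatives of $g-f$ at $x$ are bounded in absolute value by $\varepsilon(x)$ for every $x\in\mathbb{R}^n$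 (strict inequality), where $\varepsilon:\mathbb{R}^n\to(0,\infty)$ ranges over continuous positive functions. *)

theory Defs
  imports "HOL-Analysis.Analysis"
begin

section \<open>Partial derivatives and twice continuously differentiable functions\<close>

definition partial :: "'n::finite \<Rightarrow> (real^'n \<Rightarrow> real) \<Rightarrow> real^'n \<Rightarrow> real" where
  "partial i f x = deriv (\<lambda>t. f (x + t *\<^sub>R axis i 1)) 0"

definition has_partials :: "(real^'n::finite \<Rightarrow> real) \<Rightarrow> bool" where
  "has_partials f \<longleftrightarrow>
     (\<forall>i x. (\<lambda>t. f (x + t *\<^sub>R axis i 1)) field_differentiable (at 0))"

definition C2 :: "(real^'n::finite \<Rightarrow> real) set" where
  "C2 = {f. continuous_on UNIV f \<and> has_partials f \<and>
            (\<forall>i. continuous_on UNIV (partial i f) \<and> has_partials (partial i f)) \<and>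
            (\<forall>i j. continuous_on UNIV (partial i (partial j f)))}"

section \<open>The strong topology\<close>

definition C2_nbhd ::
    "(real^'n::finite \<Rightarrow> real) \<Rightarrow> (real^'n \<Rightarrow> real) \<Rightarrow> (real^'n \<Rightarrow> real) set" where
  "C2_nbhd f \<epsilon> = {g \<in> C2. \<forall>x.
      \<bar>g x - f x\<bar> < \<epsilon> x \<and>
      (\<forall>i. \<bar>partial i (\<lambda>y. g y - f y) x\<bar> < \<epsilon> x) \<and>
      (\<forall>i j. \<bar>partial i (partial j (\<lambda>y. g y - f y)) x\<bar> < \<epsilon> x)}"

definition C2s_topology :: "(real^'n::finite \<Rightarrow> real) topology" where
  "C2s_topology = topology (\<lambda>U. U \<subseteq> C2 \<and>
     (\<forall>f\<in>U. \<exists>\<epsilon>. continuous_on UNIV \<epsilon> \<and> (\<forall>x. 0 < \<epsilon> x) \<and> C2_nbhd f \<epsilon> \<subseteq> U))"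

lemma C2_nbhd_mono: "(\<And>x. \<delta> x \<le> \<epsilon> x) \<Longrightarrow> C2_nbhd f \<delta> \<subseteq> C2_nbhd f \<epsilon>"
  unfolding C2_nbhd_def by (blast intro: less_le_trans)

lemma istopology_C2s:
  "istopology (\<lambda>U. U \<subseteq> (C2 :: (real^'n::finite \<Rightarrow> real) set) \<and>
     (\<forall>f\<in>U. \<exists>\<epsilon>. continuous_on UNIV \<epsilon> \<and> (\<forall>x. 0 < \<epsilon> x) \<and> C2_nbhd f \<epsilon> \<subseteq> U))"
  (is "istopology ?P")
  unfolding istopology_def
proof (intro conjI allI impI)
  fix S T :: "(real^'n \<Rightarrow> real) set" assume S: "?P S" and T: "?P T"
  show "S \<inter> T \<subseteq> C2" using S by auto
  show "\<forall>f\<in>S \<inter> T. \<exists>\<epsilon>. continuous_on UNIV \<epsilon> \<and> (\<forall>x. 0 < \<epsilon> x) \<and> C2_nbhd f \<epsilon> \<subseteq> S \<inter> T"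
  proof
    fix f assume f: "f \<in> S \<inter> T"
    obtain a where a: "continuous_on UNIV a" "\<forall>x. 0 < a x" "C2_nbhd f a \<subseteq> S"
      using S f by blast
    obtain b where b: "continuous_on UNIV b" "\<forall>x. 0 < b x" "C2_nbhd f b \<subseteq> T"
      using T f by blast
    have "C2_nbhd f (\<lambda>x. min (a x) (b x)) \<subseteq> S \<inter> T"
      using C2_nbhd_mono[of "\<lambda>x. min (a x) (b x)" a f]
            C2_nbhd_mono[of "\<lambda>x. min (a x) (b x)" b f] a(3) b(3) by auto
    moreover have "continuous_on UNIV (\<lambda>x. min (a x) (b x))"
      using a(1) b(1) by (intro continuous_intros)
    ultimately show "\<exists>\<epsilon>. continuous_on UNIV \<epsilon> \<and> (\<forall>x. 0 < \<epsilon> x) \<and> C2_nbhd f \<epsilon> \<subseteq> S \<inter> T"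
      using a(2) b(2) by (intro exI[of _ "\<lambda>x. min (a x) (b x)"]) auto
  qed
next
  fix K :: "(real^'n \<Rightarrow> real) set set" assume K: "\<forall>U\<in>K. ?P U"
  show "\<Union>K \<subseteq> C2" using K by blast
  show "\<forall>f\<in>\<Union>K. \<exists>\<epsilon>. continuous_on UNIV \<epsilon> \<and> (\<forall>x. 0 < \<epsilon> x) \<and> C2_nbhd f \<epsilon> \<subseteq> \<Union>K"
  proof
    fix f assume "f \<in> \<Union>K"
    then obtain U where U: "U \<in> K" "f \<in> U" by blast
    then obtain \<epsilon> where "continuous_on UNIV \<epsilon>" "\<forall>x. 0 < \<epsilon> x" "C2_nbhd f \<epsilon> \<subseteq> U"
      using K by blast
    then show "\<exists>\<epsilon>. continuous_on UNIV \<epsilon> \<and> (\<forall>x. 0 < \<epsilon> x) \<and> C2_nbhd f \<epsilon> \<subseteq> \<Union>K"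
      using U(1) by blast
  qed
qed

lemma openin_C2s:
  "openin C2s_topology U \<longleftrightarrow> U \<subseteq> C2 \<and>
     (\<forall>f\<in>U. \<exists>\<epsilon>. continuous_on UNIV \<epsilon> \<and> (\<forall>x. 0 < \<epsilon> x) \<and> C2_nbhd f \<epsilon> \<subseteq> U)"
  unfolding C2s_topology_def topology_inverse'[OF istopology_C2s] ..

lemma topspace_C2s: "topspace C2s_topology = C2"
proof
  show "topspace C2s_topology \<subseteq> C2"
    using openin_topspace[of C2s_topology] unfolding openin_C2s by blast
  have "C2_nbhd f (\<lambda>_. 1) \<subseteq> C2" for f :: "real^'n \<Rightarrow> real"
    by (auto simp: C2_nbhd_def)
  then have "openin C2s_topology (C2 :: (real^'n \<Rightarrow> real) set)"
    unfolding openin_C2s by (auto intro!: exI[of _ "\<lambda>_. 1"])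
  then show "(C2 :: (real^'n \<Rightarrow> real) set) \<subseteq> topspace C2s_topology"
    by (rule openin_subset)
qed

lemma partial_diff:
  assumes "has_partials f" "has_partials g"
  shows "partial i (\<lambda>y. f y - g y) = (\<lambda>x. partial i f x - partial i g x)"
  using assms by (auto simp: partial_def has_partials_def fun_eq_iff)

lemma has_partials_diff:
  "has_partials f \<Longrightarrow> has_partials g \<Longrightarrow> has_partials (\<lambda>y. f y - g y)"
  unfolding has_partials_def by (auto intro: field_differentiable_diff)

lemma C2_diff_partials:
  assumes "f \<in> C2" "g \<in> C2"
  shows "partial i (\<lambda>y. f y - g y) = (\<lambda>x. partial i f x - partial i g x)"
    and "partial i (partial j (\<lambda>y. f y - g y)) =
           (\<lambda>x. partial i (partial j f) x - partial i (partial j g) x)"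
    and "partial i (\<lambda>x. partial j f x - partial j g x) =
           (\<lambda>x. partial i (partial j f) x - partial i (partial j g) x)"
  using assms by (simp_all add: C2_def partial_diff)

text \<open>The sets \<^term>\<open>C2_nbhd f \<epsilon>\<close> are themselves open, so they do form a
  neighbourhood base of \<^term>\<open>f\<close>.\<close>

lemma centre_in_C2_nbhd:
  assumes "f \<in> C2" "\<forall>x. 0 < \<epsilon> x"
  shows "f \<in> C2_nbhd f \<epsilon>"
  using assms by (simp add: C2_nbhd_def C2_diff_partials partial_def)

lemma openin_C2_nbhd:
  fixes f :: "real^'n::finite \<Rightarrow> real"
  assumes f: "f \<in> C2" and \<epsilon>: "continuous_on UNIV \<epsilon>"
  shows "openin C2s_topology (C2_nbhd f \<epsilon>)"
  unfolding openin_C2s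
proof (intro conjI ballI)
  show "C2_nbhd f \<epsilon> \<subseteq> C2" by (auto simp: C2_nbhd_def)
  fix g assume g: "g \<in> C2_nbhd f \<epsilon>"
  then have gC: "g \<in> C2" by (simp add: C2_nbhd_def)
  define D1 where "D1 i x = \<bar>partial i g x - partial i f x\<bar>" for i x
  define D2 where "D2 p x = \<bar>partial (fst p) (partial (snd p) g) x - partial (fst p) (partial (snd p) f) x\<bar>"
    for p x
  define F where "F = insert (\<lambda>x. \<bar>g x - f x\<bar>) (range D1 \<union> range D2)"
  have finF: "finite F" "F \<noteq> {}" by (auto simp: F_def)
  have contF: "continuous_on UNIV h" if "h \<in> F" for h
  proof -
    have "continuous_on UNIV (\<lambda>x. \<bar>g x - f x\<bar>)"
      using f gC by (auto simp: C2_def intro!: continuous_intros)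
    moreover have "continuous_on UNIV (D1 i)" for i
      unfolding D1_def using f gC by (auto simp: C2_def intro!: continuous_intros)
    moreover have "continuous_on UNIV (D2 p)" for p
      unfolding D2_def using f gC by (auto simp: C2_def intro!: continuous_intros)
    ultimately show ?thesis using that by (auto simp: F_def)
  qed
  have ltF: "h x < \<epsilon> x" if "h \<in> F" for h x
    using g that f by (auto simp: F_def D1_def D2_def C2_nbhd_def C2_diff_partials)
  have cM: "continuous_on UNIV (\<lambda>x. Max ((\<lambda>h. h x) ` G))"
    if "finite G" "G \<noteq> {}" "\<And>h. h \<in> G \<Longrightarrow> continuous_on UNIV h"
    for G :: "(real^'n \<Rightarrow> real) set"
    using that
  proof (induction rule: finite_ne_induct)
    case (insert h G)
    have "(\<lambda>x. Max ((\<lambda>h. h x) ` insert h G)) = (\<lambda>x. max (h x) (Max ((\<lambda>h. h x) ` G)))"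
      using insert.hyps by auto
    then show ?case using insert by (auto intro!: continuous_on_max)
  qed auto
  define \<delta> where "\<delta> x = \<epsilon> x - Max ((\<lambda>h. h x) ` F)" for x
  have "continuous_on UNIV \<delta>"
    unfolding \<delta>_def using cM[OF finF contF] \<epsilon> by (intro continuous_intros)
  moreover have "\<forall>x. 0 < \<delta> x" using finF ltF by (auto simp: \<delta>_def)
  moreover have "C2_nbhd g \<delta> \<subseteq> C2_nbhd f \<epsilon>"
  proof
    fix k assume k: "k \<in> C2_nbhd g \<delta>"
    then have kC: "k \<in> C2" by (simp add: C2_nbhd_def)
    have le: "h x + \<delta> x \<le> \<epsilon> x" if "h \<in> F" for h x
      using finF(1) that by (auto simp: \<delta>_def)
    have "\<bar>k x - f x\<bar> < \<epsilon> x" for x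
      using le[of "\<lambda>x. \<bar>g x - f x\<bar>" x] k by (auto simp: F_def C2_nbhd_def dest!: spec[of _ x])
    moreover have "\<bar>partial i k x - partial i f x\<bar> < \<epsilon> x" for i x
    proof -
      have "\<bar>partial i k x - partial i g x\<bar> < \<delta> x"
        using k by (auto simp: C2_nbhd_def C2_diff_partials[OF kC gC])
      then show ?thesis using le[of "D1 i" x] by (auto simp: F_def D1_def)
    qed
    moreover have "\<bar>partial i (partial j k) x - partial i (partial j f) x\<bar> < \<epsilon> x" for i j x
    proof -
      have "\<bar>partial i (partial j k) x - partial i (partial j g) x\<bar> < \<delta> x"
        using k by (auto simp: C2_nbhd_def C2_diff_partials[OF kC gC])
      then show ?thesis using le[of "D2 (i, j)" x] by (auto simp: F_def D2_def)
    qed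
    ultimately show "k \<in> C2_nbhd f \<epsilon>"
      using kC by (auto simp: C2_nbhd_def C2_diff_partials[OF kC f])
  qed
  ultimately show "\<exists>\<delta>. continuous_on UNIV \<delta> \<and> (\<forall>x. 0 < \<delta> x) \<and> C2_nbhd g \<delta> \<subseteq> C2_nbhd f \<epsilon>"
    by blast
qed

section \<open>Sparsity constrained optimization\<close>

definition I0 :: "real^'n::finite \<Rightarrow> 'n set" where
  "I0 x = {i. x $ i = 0}"

definition I1 :: "real^'n::finite \<Rightarrow> 'n set" where
  "I1 x = {i. x $ i \<noteq> 0}"

definition norm0 :: "real^'n::finite \<Rightarrow> nat" where
  "norm0 x = card {i. x $ i \<noteq> 0}"

definition sparse_vectors :: "nat \<Rightarrow> (real^'n::finite) set" where
  "sparse_vectors s = {x. norm0 x \<le> s}"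

text \<open>Nonsingularity of the matrix \<open>(A i j)\<close> with \<open>i, j\<close> ranging over \<open>I\<close>: existence of a
  two-sided inverse, as in \<^const>\<open>invertible\<close>, but for an index set instead of an index type.
  The matrix indexed by the empty set is nonsingular.\<close>

definition nonsingular_on :: "'n set \<Rightarrow> ('n \<Rightarrow> 'n \<Rightarrow> real) \<Rightarrow> bool" where
  "nonsingular_on I A \<longleftrightarrow> (\<exists>B. \<forall>i\<in>I. \<forall>j\<in>I.
     (\<Sum>k\<in>I. A i k * B k j) = (if i = j then 1 else 0) \<and>
     (\<Sum>k\<in>I. B i k * A k j) = (if i = j then 1 else 0))"

lemma nonsingular_on_UNIV:
  "nonsingular_on UNIV A \<longleftrightarrow> invertible ((\<chi> i j. A i j) :: real^'n::finite^'n)"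
proof -
  have "nonsingular_on UNIV A \<longleftrightarrow> (\<exists>B. (\<chi> i j. A i j) ** (\<chi> i j. B i j) = (mat 1 :: real^'n^'n) \<and>
      (\<chi> i j. B i j) ** (\<chi> i j. A i j) = (mat 1 :: real^'n^'n))"
    unfolding nonsingular_on_def matrix_matrix_mult_def mat_def vec_eq_iff vec_lambda_beta
    by (rule ex_cong1) blast
  also have "\<dots> \<longleftrightarrow> invertible ((\<chi> i j. A i j) :: real^'n^'n)"
    unfolding invertible_def
  proof
    assume "\<exists>B. (\<chi> i j. A i j) ** B = (mat 1 :: real^'n^'n) \<and> B ** (\<chi> i j. A i j) = mat 1"
    then obtain B where "(\<chi> i j. A i j) ** B = (mat 1 :: real^'n^'n)" "B ** (\<chi> i j. A i j) = mat 1"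
      by blast
    then show "\<exists>B. (\<chi> i j. A i j) ** (\<chi> i j. B i j) = (mat 1 :: real^'n^'n) \<and>
        (\<chi> i j. B i j) ** (\<chi> i j. A i j) = (mat 1 :: real^'n^'n)"
      by (intro exI[of _ "\<lambda>i j. B $ i $ j"]) simp
  qed blast
  finally show ?thesis .
qed

definition M_stationary :: "nat \<Rightarrow> (real^'n::finite \<Rightarrow> real) \<Rightarrow> real^'n \<Rightarrow> bool" where
  "M_stationary s f x \<longleftrightarrow> x \<in> sparse_vectors s \<and> (\<forall>i\<in>I1 x. partial i f x = 0)"

definition nondegenerate :: "nat \<Rightarrow> (real^'n::finite \<Rightarrow> real) \<Rightarrow> real^'n \<Rightarrow> bool" where
  "nondegenerate s f x \<longleftrightarrow>
     (norm0 x < s \<longrightarrow> (\<forall>i\<in>I0 x. partial i f x \<noteq> 0)) \<and>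
     nonsingular_on (I1 x) (\<lambda>i j. partial i (partial j f) x)"

definition nondegenerate_objectives :: "nat \<Rightarrow> (real^'n::finite \<Rightarrow> real) set" where
  "nondegenerate_objectives s =
     {f \<in> C2. \<forall>x. M_stationary s f x \<longrightarrow> nondegenerate s f x}"

end

(* Openness: enlarging the support of x to an index set J shows that the 2-jets of degenerate
   M-stationary points form a closed set, so the distance from the jet of f to that set, up to a
   constant factor, is an admissible radius.

   Density: f is perturbed to f + phi * (c . x + d), where phi > 0 is fixed and has a 2-jet below the
   prescribed radius.  On a given support J, a stationary point x and the value c . x + d determine
   c on J and then d.  This recovers the parameters by a C^1 map between spaces of equal dimension
   whose critical points include the points with singular Hessian, so that Sard's theorem in equal
   dimensions suffices. *)

theory Submission
  imports Defs
begin

text \<open>An affine perturbation alone is not admissible: a strong neighbourhood may prescribe any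
  decay at infinity, so c . x + d has to be damped by phi. Damping mixes the parameters, since each
  partial derivative of phi * (c . x + d) contains a multiple of the whole value c . x + d. This is
  why d is there: the value can be treated as an independent unknown l, and once x and l are given,
  each stationarity equation contains a single c_i and is solved by dividing by phi > 0. The
  dimensions match because the coordinates of x on J, the components of c off J and l are n + 1
  numbers, as many as (c, d) has. Failure of (ND1) confines x to finitely many hyperplanes, which
  the differentiable recovery map sends to a null set. Finitely many supports and a perturbation
  acting on all of R^n at once leave a single measure argument.\<close>

section \<open>Sard's theorem in Euclidean spaces\<close>

text \<open>The library's Sard theorem is stated for vectors whose index type is a well-order, and an
  arbitrary finite index type carries no order.\<close>

typedef (overloaded) 'a dim_index = "{..<DIM('a::euclidean_space)}"
  morphisms nat_of_dim_index Dim_index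
  using DIM_positive by blast

instantiation dim_index :: (euclidean_space) linorder
begin

definition "x \<le> y \<longleftrightarrow> nat_of_dim_index x \<le> nat_of_dim_index y"
definition "x < y \<longleftrightarrow> nat_of_dim_index x < nat_of_dim_index y"

instance
  by standard (auto simp: less_eq_dim_index_def less_dim_index_def nat_of_dim_index_inject)

end

instance dim_index :: (euclidean_space) wellorder
proof
  fix P :: "'a dim_index \<Rightarrow> bool" and a :: "'a dim_index"
  assume step: "\<And>x. (\<And>y. y < x \<Longrightarrow> P y) \<Longrightarrow> P x"
  show "P a"
    by (induction a rule: measure_induct_rule[of nat_of_dim_index]) (rule step, simp add: less_dim_index_def)
qed

lemma bij_betw_nat_of_dim_index:
  "bij_betw nat_of_dim_index (UNIV :: 'a::euclidean_space dim_index set) {..<DIM('a)}"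
  using type_definition.Rep_range[OF type_definition_dim_index]
  by (auto simp: bij_betw_def inj_def nat_of_dim_index_inject)

instance dim_index :: (euclidean_space) finite
  by standard (use bij_betw_finite bij_betw_nat_of_dim_index in blast)

lemma CARD_dim_index: "CARD('a::euclidean_space dim_index) = DIM('a)"
  using bij_betw_same_card[OF bij_betw_nat_of_dim_index] by fastforce

text \<open>Conjugation by a linear isomorphism \<open>h\<close> with inverse \<open>k\<close> moves
  the claim to a Cartesian space: a kernel vector v becomes the kernel vector h v, so the matrix of
  the derivative drops rank. Linear maps between spaces of equal dimension preserve negligibility,
  which brings the result back.\<close>

lemma Sard_euclidean:
  fixes f :: "'a::euclidean_space \<Rightarrow> 'a"
  assumes der: "\<And>x. x \<in> S \<Longrightarrow> (f has_derivative f' x) (at x within S)"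
    and crit: "\<And>x. x \<in> S \<Longrightarrow> \<exists>v. v \<noteq> 0 \<and> f' x v = 0"
  shows "negligible (f ` S)"
proof -
  have "DIM('a) = DIM(real^'a dim_index)" by (simp add: CARD_dim_index)
  then obtain h :: "'a \<Rightarrow> real^'a dim_index" and k
    where lin: "linear h" "linear k" and kh: "\<And>x. k (h x) = x"
    by (rule isomorphisms_UNIV_UNIV) blast
  define F' where "F' y = h \<circ> f' (k y) \<circ> k" for y
  have "negligible ((h \<circ> f \<circ> k) ` h ` S)"
  proof (rule baby_Sard)
    fix y assume "y \<in> h ` S"
    then have ky: "k y \<in> S" using kh by auto
    have kS: "k ` h ` S = S" using kh by (simp add: image_comp)
    show d: "((h \<circ> f \<circ> k) has_derivative F' y) (at y within h ` S)"
      unfolding F'_def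
      by (intro diff_chain_within linear_imp_has_derivative lin)
         (simp_all add: kS der ky)
    obtain v where v: "v \<noteq> 0" "f' (k y) v = 0" using crit ky by blast
    have "F' y (h v) = 0" by (simp add: F'_def kh v linear_0 lin)
    moreover have "h v \<noteq> 0" using v(1) kh[of v] linear_0[OF lin(2)] by auto
    ultimately have "\<not> inj (F' y)"
      using linear_injective_0[OF has_derivative_linear[OF d]] by blast
    then have "\<not> inj ((*v) (matrix (F' y)))"
      by (simp only: matrix_vector_mul(2)[OF has_derivative_linear[OF d]] not_False_eq_True)
    then show "rank (matrix (F' y)) < CARD('a dim_index)"
      by (simp add: less_rank_noninjective)
  qed simp
  then have "negligible (k ` (h \<circ> f \<circ> k) ` h ` S)"
    by (rule negligible_differentiable_image_negligible[rotated])
       (simp_all add: CARD_dim_index linear_imp_differentiable_on lin)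
  also have "k ` (h \<circ> f \<circ> k) ` h ` S = f ` S" by (simp add: image_comp comp_def kh)
  finally show ?thesis .
qed

section \<open>Calculus of twice continuously differentiable functions\<close>

lemma partial_has_derivative:
  assumes "(f has_derivative f') (at x)"
  shows "((\<lambda>t. f (x + t *\<^sub>R axis i 1)) has_field_derivative f' (axis i 1)) (at 0)"
proof -
  have "((\<lambda>t. f (x + t *\<^sub>R axis i 1)) has_derivative (\<lambda>t. f' (t *\<^sub>R axis i 1))) (at 0)"
    by (rule has_derivative_compose[where g = f, of "\<lambda>t. x + t *\<^sub>R axis i 1"])
       (auto intro!: derivative_eq_intros simp: assms)
  moreover have "f' (t *\<^sub>R axis i 1) = f' (axis i 1) * t" for t
    using linear_scale[OF has_derivative_linear[OF assms]] by simp
  ultimately show ?thesis by (simp add: has_field_derivative_def)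
qed

text \<open>Differentiability is assumed at parameter 0 only, but for every base point; sliding the
  base point along the line gives every parameter. The mean value theorem needs this on whole
  segments.\<close>

lemma has_partials_field_derivative:
  assumes "has_partials f"
  shows "((\<lambda>t. f (x + t *\<^sub>R axis i 1)) has_field_derivative partial i f (x + t *\<^sub>R axis i 1)) (at t)"
proof -
  let ?y = "x + t *\<^sub>R axis i 1"
  have "((\<lambda>u. f (?y + u *\<^sub>R axis i 1)) has_field_derivative partial i f ?y) (at 0)"
    using assms unfolding has_partials_def partial_def
    by (simp add: DERIV_deriv_iff_field_differentiable)
  then have "((\<lambda>u. f (x + u *\<^sub>R axis i 1)) has_field_derivative partial i f ?y) (at (0 + t))"
    by (subst DERIV_shift) (simp add: scaleR_add_left add_ac)
  then show ?thesis by simp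
qed

text \<open>\<open>C2\<close> speaks only of derivatives along coordinate lines. Total
  differentiability comes from walking from x to y one coordinate at a time, with the mean value
  theorem on each leg.\<close>

lemma continuous_partials_imp_has_derivative:
  fixes f :: "real^'n::finite \<Rightarrow> real"
  assumes f: "has_partials f" and cont: "\<And>i. continuous_on UNIV (partial i f)"
  shows "(f has_derivative (\<lambda>v. \<Sum>i\<in>UNIV. v $ i * partial i f x)) (at x)"
proof -
  have bl: "bounded_linear (\<lambda>v::real^'n. \<Sum>i\<in>UNIV. v $ i * partial i f x)"
    by (intro bounded_linear_sum bounded_linear_mult_left[THEN bounded_linear_compose]
        bounded_linear_vec_nth)
  show ?thesis
    unfolding has_derivative_at_alt
  proof (intro conjI bl allI impI)
    fix e :: real assume "e > 0"
    \<comment> \<open>Each of the CARD('n) legs contributes an error of at most e' times the norm of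
      y - x.\<close>
    define e' where "e' = e / CARD('n)"
    have e': "e' > 0" using \<open>e > 0\<close> by (simp add: e'_def)
    have "\<forall>i. \<exists>d>0. \<forall>y. norm (y - x) < d \<longrightarrow> \<bar>partial i f y - partial i f x\<bar> < e'"
      using cont e' unfolding continuous_on_iff by (metis UNIV_I dist_norm dist_real_def)
    then obtain d where d: "\<And>i. d i > 0"
      "\<And>i y. norm (y - x) < d i \<Longrightarrow> \<bar>partial i f y - partial i f x\<bar> < e'" by metis
    define \<delta> where "\<delta> = Min (range d)"
    have \<delta>: "\<delta> > 0" using d(1) by (auto simp: \<delta>_def)
    have \<delta>d: "\<delta> \<le> d i" for i by (simp add: \<delta>_def)
    have "\<bar>f y - f x - (\<Sum>i\<in>UNIV. (y - x) $ i * partial i f x)\<bar> \<le> e * norm (y - x)"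
      if y: "norm (y - x) < \<delta>" for y
    proof -
      define v where "v = y - x"
      \<comment> \<open>The part of the increment already travelled; induction over finite sets
        visits the coordinates in an arbitrary order.\<close>
      define p where "p I = (\<chi> i. if i \<in> I then v $ i else 0)" for I
      have main: "\<bar>f (x + p I) - f x - (\<Sum>i\<in>I. v $ i * partial i f x)\<bar> \<le> real (card I) * (e' * norm v)"
        if "finite I" for I
        using that
      proof induction
        case empty
        have "p {} = 0" by (simp add: p_def vec_eq_iff)
        then show ?case by simp
      next
        case (insert j I)
        define g where "g t = f (x + p I + t *\<^sub>R axis j 1)" for t
        have "\<exists>\<xi>. \<bar>\<xi>\<bar> \<le> \<bar>v $ j\<bar> \<and> g (v $ j) - g 0 = v $ j * partial j f (x + p I + \<xi> *\<^sub>R axis j 1)"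
        proof -
          have der: "(g has_field_derivative partial j f (x + p I + t *\<^sub>R axis j 1)) (at t)" for t
            unfolding g_def by (rule has_partials_field_derivative[OF f])
          consider "v $ j = 0" | "v $ j > 0" | "v $ j < 0" by linarith
          then show ?thesis
          proof cases
            case 2
            obtain z where "0 < z" "z < v $ j"
              "g (v $ j) - g 0 = (v $ j - 0) * partial j f (x + p I + z *\<^sub>R axis j 1)"
              using MVT2[OF 2, of g, OF der] by blast
            then show ?thesis by (intro exI[of _ z]) auto
          next
            case 3
            obtain z where "v $ j < z" "z < 0"
              "g 0 - g (v $ j) = (0 - v $ j) * partial j f (x + p I + z *\<^sub>R axis j 1)"
              using MVT2[OF 3, of g, OF der] by blast
            then show ?thesis by (intro exI[of _ z]) auto
          qed auto
        qed
        then obtain \<xi> where \<xi>: "\<bar>\<xi>\<bar> \<le> \<bar>v $ j\<bar>"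
          "g (v $ j) - g 0 = v $ j * partial j f (x + p I + \<xi> *\<^sub>R axis j 1)" by blast
        have "p (insert j I) = p I + v $ j *\<^sub>R axis j 1"
          using insert.hyps by (auto simp: p_def vec_eq_iff axis_def)
        then have g: "g (v $ j) = f (x + p (insert j I))" "g 0 = f (x + p I)"
          by (simp_all add: g_def add.assoc)
        \<comment> \<open>Every coordinate is bounded by that of v, so the intermediate point stays
          in the ball where the partials are controlled.\<close>
        have "norm (p I + \<xi> *\<^sub>R axis j 1) \<le> norm v"
          using insert.hyps \<xi>(1) by (intro norm_le_componentwise_cart) (auto simp: p_def axis_def)
        then have "norm (p I + \<xi> *\<^sub>R axis j 1) < d j" using y \<delta>d[of j] by (simp add: v_def)
        then have "\<bar>partial j f (x + p I + \<xi> *\<^sub>R axis j 1) - partial j f x\<bar> < e'"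
          by (intro d(2)) (simp add: add.assoc)
        then have "\<bar>v $ j\<bar> * \<bar>partial j f (x + p I + \<xi> *\<^sub>R axis j 1) - partial j f x\<bar> \<le> norm v * e'"
          by (intro mult_mono) (auto simp: component_le_norm_cart)
        then have "\<bar>g (v $ j) - g 0 - v $ j * partial j f x\<bar> \<le> e' * norm v"
          unfolding \<xi>(2) by (simp add: abs_mult[symmetric] right_diff_distrib mult.commute)
        then show ?case using insert by (simp add: g algebra_simps)
      qed
      have "p UNIV = v" by (simp add: p_def vec_eq_iff)
      then show ?thesis using main[of UNIV] by (simp add: v_def e'_def)
    qed
    then show "\<exists>d>0. \<forall>y. norm (y - x) < d \<longrightarrow>
        norm (f y - f x - (\<Sum>i\<in>UNIV. (y - x) $ i * partial i f x)) \<le> e * norm (y - x)"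
      using \<delta> by auto
  qed
qed

lemma
  fixes f :: "real^'n::finite \<Rightarrow> real"
  assumes "f \<in> C2"
  shows C2_has_derivative: "(f has_derivative (\<lambda>v. \<Sum>i\<in>UNIV. v $ i * partial i f x)) (at x)"
    and C2_partial_has_derivative:
      "(partial i f has_derivative (\<lambda>v. \<Sum>j\<in>UNIV. v $ j * partial j (partial i f) x)) (at x)"
  using assms by (auto simp: C2_def intro!: continuous_partials_imp_has_derivative)

lemma gradient_partials:
  fixes f :: "real^'n::finite \<Rightarrow> real"
  assumes "\<And>x. (f has_derivative (\<lambda>v. \<Sum>i\<in>UNIV. v $ i * F i x)) (at x)"
  shows "has_partials f" "partial i f = F i" "continuous_on UNIV f"
proof -
  have "((\<lambda>t. f (x + t *\<^sub>R axis i 1)) has_field_derivative F i x) (at 0)" for i x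
    using partial_has_derivative[OF assms, of x i] by (simp add: axis_def if_distrib[of "\<lambda>u. u * _"] cong: if_cong)
  then show "has_partials f" "partial i f = F i"
    by (auto simp: has_partials_def partial_def fun_eq_iff field_differentiable_def intro!: DERIV_imp_deriv)
  show "continuous_on UNIV f"
    using assms by (meson continuous_at_imp_continuous_on has_derivative_continuous)
qed

lemma
  fixes f :: "real^'n::finite \<Rightarrow> real"
  assumes 1: "\<And>x. (f has_derivative (\<lambda>v. \<Sum>i\<in>UNIV. v $ i * F i x)) (at x)"
    and 2: "\<And>i x. (F i has_derivative (\<lambda>v. \<Sum>j\<in>UNIV. v $ j * G j i x)) (at x)"
    and "\<And>i j. continuous_on UNIV (G j i)"
  shows C2I: "f \<in> C2" and C2_partialI: "partial i f = F i"
    and C2_partial_partialI: "partial j (partial i f) = G j i"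
  using gradient_partials[OF 1] gradient_partials[OF 2] assms(3) by (auto simp: C2_def)

lemma
  fixes f g :: "real^'n::finite \<Rightarrow> real"
  assumes f: "f \<in> C2" and g: "g \<in> C2"
  shows C2_add: "(\<lambda>x. f x + g x) \<in> C2"
    and partial_add: "partial i (\<lambda>x. f x + g x) = (\<lambda>x. partial i f x + partial i g x)"
    and partial_partial_add: "partial j (partial i (\<lambda>x. f x + g x)) =
           (\<lambda>x. partial j (partial i f) x + partial j (partial i g) x)"
proof -
  have 1: "((\<lambda>x. f x + g x) has_derivative
      (\<lambda>v. \<Sum>i\<in>UNIV. v $ i * (partial i f x + partial i g x))) (at x)" for x
    using has_derivative_add[OF C2_has_derivative[OF f] C2_has_derivative[OF g]]
    by (simp add: distrib_left sum.distrib)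
  have 2: "((\<lambda>x. partial i f x + partial i g x) has_derivative
      (\<lambda>v. \<Sum>j\<in>UNIV. v $ j * (partial j (partial i f) x + partial j (partial i g) x))) (at x)" for i x
    using has_derivative_add[OF C2_partial_has_derivative[OF f] C2_partial_has_derivative[OF g]]
    by (simp add: distrib_left sum.distrib)
  have 3: "continuous_on UNIV (\<lambda>x. partial j (partial i f) x + partial j (partial i g) x)" for i j
    using f g by (auto simp: C2_def intro!: continuous_intros)
  show "(\<lambda>x. f x + g x) \<in> C2" by (rule C2I[OF 1 2 3])
  show "partial i (\<lambda>x. f x + g x) = (\<lambda>x. partial i f x + partial i g x)"
    by (rule C2_partialI[OF 1 2 3])
  show "partial j (partial i (\<lambda>x. f x + g x)) =
           (\<lambda>x. partial j (partial i f) x + partial j (partial i g) x)"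
    by (rule C2_partial_partialI[OF 1 2 3])
qed

lemma
  fixes \<phi> :: "real^'n::finite \<Rightarrow> real"
  assumes \<phi>: "\<phi> \<in> C2"
  shows C2_mult_affine: "(\<lambda>x. \<phi> x * (c \<bullet> x + d)) \<in> C2"
    and partial_mult_affine: "partial i (\<lambda>x. \<phi> x * (c \<bullet> x + d)) =
      (\<lambda>x. partial i \<phi> x * (c \<bullet> x + d) + \<phi> x * c $ i)"
    and partial_partial_mult_affine: "partial j (partial i (\<lambda>x. \<phi> x * (c \<bullet> x + d))) =
      (\<lambda>x. partial j (partial i \<phi>) x * (c \<bullet> x + d) + partial i \<phi> x * c $ j + partial j \<phi> x * c $ i)"
proof -
  have lin: "(\<Sum>i\<in>UNIV. v $ i * (p i * L + q * c $ i)) = (\<Sum>i\<in>UNIV. v $ i * p i) * L + q * (c \<bullet> v)"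
    for v :: "real^'n" and p L q
    by (simp add: inner_vec_def sum_distrib_left sum_distrib_right sum.distrib algebra_simps)
  have lin2: "(\<Sum>i\<in>UNIV. v $ i * (p i * L + q * c $ i + r i * b)) =
      (\<Sum>i\<in>UNIV. v $ i * p i) * L + q * (c \<bullet> v) + (\<Sum>i\<in>UNIV. v $ i * r i) * b"
    for v :: "real^'n" and p L q r b
    by (simp add: inner_vec_def sum_distrib_left sum_distrib_right sum.distrib algebra_simps)
  have 1: "((\<lambda>x. \<phi> x * (c \<bullet> x + d)) has_derivative
      (\<lambda>v. \<Sum>i\<in>UNIV. v $ i * (partial i \<phi> x * (c \<bullet> x + d) + \<phi> x * c $ i))) (at x)" for x
    unfolding lin by (auto intro!: derivative_eq_intros C2_has_derivative[OF \<phi>] simp: fun_eq_iff)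
  have 2: "((\<lambda>x. partial i \<phi> x * (c \<bullet> x + d) + \<phi> x * c $ i) has_derivative
      (\<lambda>v. \<Sum>j\<in>UNIV. v $ j * (partial j (partial i \<phi>) x * (c \<bullet> x + d) + partial i \<phi> x * c $ j + partial j \<phi> x * c $ i))) (at x)" for i x
    unfolding lin2 by (auto intro!: derivative_eq_intros C2_has_derivative[OF \<phi>]
        C2_partial_has_derivative[OF \<phi>] simp: fun_eq_iff)
  have 3: "continuous_on UNIV (\<lambda>x. partial j (partial i \<phi>) x * (c \<bullet> x + d) + partial i \<phi> x * c $ j + partial j \<phi> x * c $ i)" for i j
    using \<phi> by (auto simp: C2_def intro!: continuous_intros)
  show "(\<lambda>x. \<phi> x * (c \<bullet> x + d)) \<in> C2" by (rule C2I[OF 1 2 3])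
  show "partial i (\<lambda>x. \<phi> x * (c \<bullet> x + d)) =
      (\<lambda>x. partial i \<phi> x * (c \<bullet> x + d) + \<phi> x * c $ i)"
    by (rule C2_partialI[OF 1 2 3])
  show "partial j (partial i (\<lambda>x. \<phi> x * (c \<bullet> x + d))) =
      (\<lambda>x. partial j (partial i \<phi>) x * (c \<bullet> x + d) + partial i \<phi> x * c $ j + partial j \<phi> x * c $ i)"
    by (rule C2_partial_partialI[OF 1 2 3])
qed

section \<open>Small positive functions\<close>

text \<open>\<open>D t\<close> is the infimum of \<epsilon> plus a penalty for x . x exceeding t.
  Each penalized function is nonincreasing and 1-Lipschitz in t, and both properties pass to the
  infimum. The penalty vanishes at t = x . x, which gives the upper bound.\<close>

lemma exists_radial_minorant:
  fixes \<epsilon> :: "'a::euclidean_space \<Rightarrow> real"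
  assumes cont: "continuous_on UNIV \<epsilon>" and pos: "\<And>x. 0 < \<epsilon> x"
  obtains D :: "real \<Rightarrow> real" where "continuous_on UNIV D" "antimono D" "\<And>t. 0 < D t"
    "\<And>x. D (x \<bullet> x) \<le> \<epsilon> x"
proof
  define w where "w t x = \<epsilon> x + max 0 (x \<bullet> x - t)" for t and x :: 'a
  define D where "D t = (INF x. w t x)" for t
  have bdd: "bdd_below (range (w t))" for t
    by (rule bdd_belowI[of _ 0]) (auto simp: w_def intro!: add_nonneg_nonneg less_imp_le[OF pos])
  have D_le: "D t \<le> w t x" for t x
    unfolding D_def by (rule cINF_lower[OF bdd]) simp
  have D_ge: "m \<le> D t" if "\<And>x. m \<le> w t x" for m t
    unfolding D_def by (rule cINF_greatest) (use that in auto)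
  show "D (x \<bullet> x) \<le> \<epsilon> x" for x
    using D_le[of "x \<bullet> x" x] by (simp add: w_def)
  show "antimono D"
  proof
    fix s t :: real assume "s \<le> t"
    then have "w t x \<le> w s x" for x by (simp add: w_def)
    then show "D t \<le> D s" using D_le order_trans by (intro D_ge) blast
  qed
  have lip: "D t \<le> D s + \<bar>s - t\<bar>" for s t
  proof -
    have "D t - \<bar>s - t\<bar> \<le> w s x" for x
      using D_le[of t x] by (auto simp: w_def)
    then have "D t - \<bar>s - t\<bar> \<le> D s" by (rule D_ge)
    then show ?thesis by simp
  qed
  have "\<bar>D s - D t\<bar> \<le> \<bar>s - t\<bar>" for s t
    using lip[of s t] lip[of t s] by linarith
  then show "continuous_on UNIV D"
    unfolding continuous_on_iff dist_real_def by (metis le_less_trans)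
  show "0 < D t" for t
  proof -
    \<comment> \<open>Outside this ball x . x is at least t + 1, so the penalty is at least 1;
      inside, \<epsilon> attains a positive minimum. Together they bound the infimum away from
      0.\<close>
    have "compact (cball 0 (\<bar>t\<bar> + 1) :: 'a set)" by simp
    then obtain m where m: "m \<in> cball 0 (\<bar>t\<bar> + 1)" "\<And>x. x \<in> cball 0 (\<bar>t\<bar> + 1) \<Longrightarrow> \<epsilon> m \<le> \<epsilon> x"
      using continuous_attains_inf[of "cball 0 (\<bar>t\<bar> + 1)" \<epsilon>] continuous_on_subset[OF cont]
      by (metis cball_eq_empty abs_ge_zero add_nonneg_pos not_less subset_UNIV zero_less_one less_imp_le)
    have "min (\<epsilon> m) 1 \<le> w t x" for x
    proof (cases "norm x \<le> \<bar>t\<bar> + 1")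
      case True
      then show ?thesis using m(2)[of x] by (simp add: w_def)
    next
      case False
      then have "(\<bar>t\<bar> + 1)\<^sup>2 \<le> (norm x)\<^sup>2" by (intro power_mono) auto
      moreover have "t + 1 \<le> (\<bar>t\<bar> + 1)\<^sup>2"
        using zero_le_square[of t] abs_ge_self[of t] abs_ge_zero[of t]
        unfolding power2_sum by (simp add: power2_eq_square, linarith)
      ultimately have "t + 1 \<le> x \<bullet> x" by (simp add: power2_norm_eq_inner)
      then show ?thesis using pos[of x] by (simp add: w_def)
    qed
    then have "min (\<epsilon> m) 1 \<le> D t" by (rule D_ge)
    then show ?thesis using pos[of m] by linarith
  qed
qed

text \<open>Since D is nonincreasing, k u is at most D t * exp (- u) for u beyond t, and that
  majorant integrates to D t * exp (- t). So the tail integral obeys the same bound as k, and the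
  construction can be iterated.\<close>

lemma tail_integral:
  fixes D k :: "real \<Rightarrow> real"
  assumes D: "antimono D" and k: "continuous_on UNIV k"
    and pos: "\<And>t. 0 < k t" and le: "\<And>t. k t \<le> D t * exp (- t)"
  shows tail_integral_has_derivative:
      "((\<lambda>t. integral {t..} k) has_field_derivative - k t) (at t)"
    and tail_integral_pos: "0 < integral {t..} k"
    and tail_integral_le: "integral {t..} k \<le> D t * exp (- t)"
proof -
  have exp: "((\<lambda>u. D t * exp (- u)) has_integral D t * exp (- t)) {t..}" for t
    using has_integral_mult_right[OF has_integral_exp_minus_to_infinity[of 1 t], of "D t"] by simp
  have bound: "k u \<le> D t * exp (- u)" if "t \<le> u" for t u
    using le[of u] antimonoD[OF D that] by (meson exp_ge_zero mult_right_mono order_trans)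
  have int: "k integrable_on {t..}" for t
  proof (rule measurable_bounded_by_integrable_imp_integrable)
    show "k \<in> borel_measurable (lebesgue_on {t..})"
      by (intro continuous_imp_measurable_on_sets_lebesgue continuous_on_subset[OF k]) auto
    show "(\<lambda>u. D t * exp (- u)) integrable_on {t..}" using exp by blast
    show "norm (k u) \<le> D t * exp (- u)" if "u \<in> {t..}" for u
      using bound[of t u] pos[of u] that by simp
  qed simp
  have int': "k integrable_on {a..b}" for a b
    by (intro integrable_continuous_interval continuous_on_subset[OF k]) auto
  have split: "integral {t..} k = integral {t..b} k + integral {b..} k" if "t \<le> b" for t b
  proof -
    have "{t..} = {t..b} \<union> {b..}" "{t..b} \<inter> {b..} = {b}" using that by auto
    then show ?thesis using integral_Un[OF int' int, of t b b] by simp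
  qed
  show "integral {t..} k \<le> D t * exp (- t)"
    using has_integral_le[OF integrable_integral[OF int] exp[of t]] bound by auto
  have "0 \<le> integral {t + 1..} k" using pos less_imp_le by (intro integral_nonneg int) blast
  moreover have "0 < integral {t..t + 1} k"
    using integral_less_real[of t "t+1" "\<lambda>_. 0" k] pos k continuous_on_subset by fastforce
  ultimately show "0 < integral {t..} k" using split[of t "t + 1"] by simp
  \<comment> \<open>Differentiation takes place on a compact interval around t; the tail beyond t +
    1 is a constant there.\<close>
  have "((\<lambda>u. integral {u..t + 1} k) has_vector_derivative - k t) (at t within {t - 1..t + 1})"
    by (intro integral_has_vector_derivative' continuous_on_subset[OF k]) auto
  then have "((\<lambda>u. integral {u..t + 1} k) has_field_derivative - k t) (at t)"
    by (simp add: has_real_derivative_iff_has_vector_derivative at_within_interior[of t "{t - 1..t + 1}"])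
  then have "((\<lambda>u. integral {u..t + 1} k + integral {t + 1..} k) has_field_derivative - k t) (at t)"
    by (auto intro!: derivative_eq_intros)
  then show "((\<lambda>t. integral {t..} k) has_field_derivative - k t) (at t)"
    by (rule has_field_derivative_transform_within_open[of _ _ _ "{..<t + 1}"]) (auto intro: split[symmetric])
qed

text \<open>D is merely continuous, so two derivatives are gained by two tail integrations; the
  factor exp (- t) makes them converge and is at most 1 for nonnegative t, the only values that a
  squared norm takes.\<close>

lemma exists_flat_function:
  fixes D :: "real \<Rightarrow> real"
  assumes D: "continuous_on UNIV D" "antimono D" and pos: "\<And>t. 0 < D t"
  obtains h h' h'' where
    "\<And>t. (h has_field_derivative h' t) (at t)" "\<And>t. (h' has_field_derivative h'' t) (at t)"
    "continuous_on UNIV h''" "\<And>t. 0 < h t"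
    "\<And>t. 0 \<le> t \<Longrightarrow> \<bar>h t\<bar> \<le> D t" "\<And>t. 0 \<le> t \<Longrightarrow> \<bar>h' t\<bar> \<le> D t" "\<And>t. 0 \<le> t \<Longrightarrow> \<bar>h'' t\<bar> \<le> D t"
proof
  define k where "k t = D t * exp (- t)" for t
  define k1 where "k1 t = integral {t..} k" for t
  define h where "h t = integral {t..} k1" for t
  have le1: "D t * exp (- t) \<le> D t" if "0 \<le> t" for t
    using that pos[of t] by (intro mult_right_le_one_le) auto
  have k: "continuous_on UNIV k" "\<And>t. 0 < k t" "\<And>t. k t \<le> D t * exp (- t)"
    using D pos by (auto simp: k_def intro!: continuous_intros)
  note k1 = tail_integral[OF D(2) k, folded k1_def]
  have "continuous_on UNIV k1"
    using k1(1) by (meson DERIV_isCont continuous_at_imp_continuous_on)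
  note h = tail_integral[OF D(2) this k1(2,3), folded h_def]
  show "(h has_field_derivative - k1 t) (at t)" "0 < h t" for t by fact+
  show "((\<lambda>t. - k1 t) has_field_derivative k t) (at t)" for t
    using k1(1)[of t] by (auto intro!: derivative_eq_intros)
  show "continuous_on UNIV k" by fact
  show "\<bar>h t\<bar> \<le> D t" "\<bar>- k1 t\<bar> \<le> D t" "\<bar>k t\<bar> \<le> D t" if "0 \<le> t" for t
    using le1[OF that] h(2,3)[of t] k1(2,3)[of t] k(2,3)[of t] by linarith+
qed

text \<open>Composing with x . x instead of the norm keeps the function twice differentiable at the
  origin. The price is polynomial factors from the chain rule.\<close>

lemma exists_small_C2:
  fixes \<epsilon> :: "real^'n::finite \<Rightarrow> real"
  assumes cont: "continuous_on UNIV \<epsilon>" and pos: "\<And>x. 0 < \<epsilon> x"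
  obtains \<phi> where "\<phi> \<in> C2" "\<And>x. 0 < \<phi> x" "\<And>x. \<bar>\<phi> x\<bar> \<le> \<epsilon> x"
    "\<And>i x. \<bar>partial i \<phi> x\<bar> \<le> \<epsilon> x" "\<And>i j x. \<bar>partial i (partial j \<phi>) x\<bar> \<le> \<epsilon> x"
proof -
  \<comment> \<open>The denominator dominates the total coefficients 1, 2 |x_i| and 2 + 4 |x_i|
    |x_j| in the value, gradient and Hessian estimates. With norm x + 1 in place of norm x, the base
    is at most its square.\<close>
  define \<eta> where "\<eta> x = \<epsilon> x / (2 + 4 * (norm x + 1)\<^sup>2)" for x :: "real^'n"
  have den: "0 < 2 + 4 * (norm x + 1)\<^sup>2" for x :: "real^'n" by (intro add_pos_nonneg) auto
  have "continuous_on UNIV \<eta>"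
    unfolding \<eta>_def using den by (intro continuous_intros cont) (metis less_irrefl)
  moreover have "0 < \<eta> x" for x using pos den by (simp add: \<eta>_def)
  ultimately obtain D where D: "continuous_on UNIV D" "antimono D" "\<And>t. 0 < D t"
    and D\<eta>: "\<And>x::real^'n. D (x \<bullet> x) \<le> \<eta> x"
    by (rule exists_radial_minorant) blast
  from D obtain h h' h'' where h: "\<And>t. (h has_field_derivative h' t) (at t)"
    "\<And>t. (h' has_field_derivative h'' t) (at t)"
    "continuous_on UNIV h''" "\<And>t. 0 < h t"
    and le: "\<And>t. 0 \<le> t \<Longrightarrow> \<bar>h t\<bar> \<le> D t" "\<And>t. 0 \<le> t \<Longrightarrow> \<bar>h' t\<bar> \<le> D t" "\<And>t. 0 \<le> t \<Longrightarrow> \<bar>h'' t\<bar> \<le> D t"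
    by (rule exists_flat_function) blast
  define \<phi> where "\<phi> x = h (x \<bullet> x)" for x :: "real^'n"
  define F where "F i x = 2 * x $ i * h' (x \<bullet> x)" for i and x :: "real^'n"
  define G where "G j i x = (if j = i then 2 * h' (x \<bullet> x) else 0) + 4 * x $ i * x $ j * h'' (x \<bullet> x)"
    for j i and x :: "real^'n"
  have comp: "((\<lambda>x. u (x \<bullet> x)) has_derivative (\<lambda>v. u' (x \<bullet> x) * (2 * (x \<bullet> v)))) (at x)"
    if "\<And>t. (u has_field_derivative u' t) (at t)" for u u' and x :: "real^'n"
    by (rule has_derivative_eq_rhs,
        rule has_derivative_compose[OF _ that[THEN has_field_derivative_imp_has_derivative], of "\<lambda>x. x \<bullet> x"])
       (auto intro!: derivative_eq_intros simp: inner_commute)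
  have 1: "(\<phi> has_derivative (\<lambda>v. \<Sum>i\<in>UNIV. v $ i * F i x)) (at x)" for x
    unfolding \<phi>_def F_def
    by (rule has_derivative_eq_rhs[OF comp[OF h(1)]])
       (simp add: fun_eq_iff inner_vec_def sum_distrib_left mult_ac)
  have 2: "(F i has_derivative (\<lambda>v. \<Sum>j\<in>UNIV. v $ j * G j i x)) (at x)" for i x
  proof -
    have "(F i has_derivative (\<lambda>v. 2 * x $ i * (h'' (x \<bullet> x) * (2 * (x \<bullet> v))) + 2 * v $ i * h' (x \<bullet> x))) (at x)"
      unfolding F_def
      by (rule has_derivative_mult[OF has_derivative_mult_right comp[OF h(2)]])
         (rule bounded_linear_imp_has_derivative[OF bounded_linear_vec_nth])
    moreover have "(\<Sum>j\<in>UNIV. v $ j * G j i x) =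
        2 * x $ i * (h'' (x \<bullet> x) * (2 * (x \<bullet> v))) + 2 * v $ i * h' (x \<bullet> x)" for v
      by (simp add: G_def inner_vec_def sum_distrib_left distrib_left sum.distrib if_distrib[of "\<lambda>u. _ * u"] mult_ac cong: if_cong)
    ultimately show ?thesis by simp
  qed
  have h': "continuous_on UNIV h'"
    using h(2) by (meson DERIV_isCont continuous_at_imp_continuous_on)
  have "continuous_on UNIV (\<lambda>x::real^'n. h' (x \<bullet> x))" "continuous_on UNIV (\<lambda>x::real^'n. h'' (x \<bullet> x))"
    by (auto intro!: continuous_on_compose2[OF h'] continuous_on_compose2[OF h(3)] continuous_intros)
  then have 3: "continuous_on UNIV (G j i)" for i j
    unfolding G_def by (cases "i = j") (auto intro!: continuous_intros)
  note C2 = C2I[OF 1 2 3] C2_partialI[OF 1 2 3] C2_partial_partialI[OF 1 2 3]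
  have b: "\<bar>h (x \<bullet> x)\<bar> \<le> \<eta> x" "\<bar>h' (x \<bullet> x)\<bar> \<le> \<eta> x" "\<bar>h'' (x \<bullet> x)\<bar> \<le> \<eta> x" for x :: "real^'n"
    using le[of "x \<bullet> x"] D\<eta>[of x] by (auto intro: order_trans)
  have \<eta>\<epsilon>: "(2 + 4 * (norm x + 1)\<^sup>2) * \<eta> x = \<epsilon> x" for x
    using den[of x] by (simp add: \<eta>_def)
  have \<eta>0: "0 \<le> \<eta> x" for x using b(1)[of x] by linarith
  have n1: "\<bar>x $ i\<bar> \<le> norm x + 1" for i and x :: "real^'n"
    using component_le_norm_cart[of x i] by simp
  have sq: "norm x + 1 \<le> (norm x + 1)\<^sup>2" for x :: "real^'n"
    by (rule self_le_power) auto
  have le24: "a \<le> q \<Longrightarrow> 0 \<le> q \<Longrightarrow> 2 * a \<le> 2 + 4 * q" for a q :: real by simp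
  show ?thesis
  proof (rule that[OF C2(1)])
    show "0 < \<phi> x" for x by (simp add: \<phi>_def h)
    show "\<bar>\<phi> x\<bar> \<le> \<epsilon> x" for x
    proof -
      have "1 * \<eta> x \<le> (2 + 4 * (norm x + 1)\<^sup>2) * \<eta> x"
        by (intro mult_right_mono \<eta>0) (use zero_le_power2[of "norm x + 1"] in linarith)
      then show ?thesis using b(1)[of x] unfolding \<eta>\<epsilon> \<phi>_def by linarith
    qed
    show "\<bar>partial i \<phi> x\<bar> \<le> \<epsilon> x" for i x
    proof -
      have "\<bar>F i x\<bar> = 2 * \<bar>x $ i\<bar> * \<bar>h' (x \<bullet> x)\<bar>" by (simp add: F_def abs_mult)
      also have "\<dots> \<le> (2 * (norm x + 1)) * \<eta> x"
        by (intro mult_mono b \<eta>0) (use n1[of x i] in auto)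
      also have "\<dots> \<le> (2 + 4 * (norm x + 1)\<^sup>2) * \<eta> x"
        by (intro mult_right_mono \<eta>0 le24 sq) simp
      finally show ?thesis unfolding \<eta>\<epsilon> C2 .
    qed
    show "\<bar>partial i (partial j \<phi>) x\<bar> \<le> \<epsilon> x" for i j x
    proof -
      have "\<bar>G i j x\<bar> \<le> 2 * \<bar>h' (x \<bullet> x)\<bar> + 4 * (\<bar>x $ j\<bar> * \<bar>x $ i\<bar>) * \<bar>h'' (x \<bullet> x)\<bar>"
        unfolding G_def by (rule order_trans[OF abs_triangle_ineq]) (auto simp: abs_mult)
      also have "\<dots> \<le> 2 * \<eta> x + 4 * ((norm x + 1) * (norm x + 1)) * \<eta> x"
        by (intro add_mono mult_mono b n1 \<eta>0) auto
      also have "\<dots> = (2 + 4 * (norm x + 1)\<^sup>2) * \<eta> x"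
        by (simp add: power2_eq_square algebra_simps)
      finally show ?thesis unfolding \<eta>\<epsilon> C2(3) .
    qed
  qed
qed

section \<open>Openness\<close>

text \<open>The identity on the complement of I turns nonsingularity over an index subset into a
  condition on a full determinant, which is continuous in the entries.\<close>

definition padded :: "'n set \<Rightarrow> ('n \<Rightarrow> 'n \<Rightarrow> real) \<Rightarrow> real^'n::finite^'n" where
  "padded I A = (\<chi> i j. if i \<in> I \<and> j \<in> I then A i j else if i = j then 1 else 0)"

text \<open>The rows and columns of \<open>padded I A\<close> with index in I are supported in I.
  Hence padding an inverse of the block inverts the padded matrix, and the I-block of an inverse of
  the padded matrix inverts the block.\<close>

lemma nonsingular_on_iff_det:
  fixes A :: "'n::finite \<Rightarrow> 'n \<Rightarrow> real"
  shows "nonsingular_on I A \<longleftrightarrow> det (padded I A) \<noteq> 0"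
proof -
  have pad: "padded I A $ i $ k = (if k \<in> I then A i k else 0)" if "i \<in> I" for A :: "'n \<Rightarrow> 'n \<Rightarrow> real" and i k
    using that by (auto simp: padded_def)
  have pad': "padded I A $ i $ k = (if i = k then 1 else 0)" if "i \<notin> I" for A :: "'n \<Rightarrow> 'n \<Rightarrow> real" and i k
    using that by (auto simp: padded_def)
  have row: "(\<Sum>k\<in>UNIV. padded I A $ i $ k * C k) = (if i \<in> I then \<Sum>k\<in>I. A i k * C k else C i)"
    for A :: "'n \<Rightarrow> 'n \<Rightarrow> real" and C i
    by (simp add: pad pad' if_distrib[of "\<lambda>u. u * _"] sum.If_cases cong: if_cong)
  have col: "(\<Sum>k\<in>UNIV. C k * padded I A $ k $ j) = (\<Sum>k\<in>I. C k * A k j)" if "j \<in> I"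
    for A :: "'n \<Rightarrow> 'n \<Rightarrow> real" and C j
  proof -
    have "(\<Sum>k\<in>UNIV. C k * padded I A $ k $ j) = (\<Sum>k\<in>I. C k * padded I A $ k $ j)"
      using that by (intro sum.mono_neutral_right) (auto simp: padded_def)
    then show ?thesis using that by (simp add: padded_def)
  qed
  have inv: "padded I A ** padded I B = mat 1"
    if "\<forall>i\<in>I. \<forall>j\<in>I. (\<Sum>k\<in>I. A i k * B k j) = (if i = j then 1 else 0)" for A B :: "'n \<Rightarrow> 'n \<Rightarrow> real"
  proof -
    have "(padded I A ** padded I B) $ i $ j =
        (if i \<in> I then \<Sum>k\<in>I. A i k * padded I B $ k $ j else padded I B $ i $ j)" for i j
      by (simp add: matrix_matrix_mult_def row)
    then have "(padded I A ** padded I B) $ i $ j = mat 1 $ i $ j" for i j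
      using that by (auto simp: pad pad' mat_def cong: sum.cong_simp)
    then show ?thesis by (simp add: vec_eq_iff)
  qed
  show ?thesis
  proof
    assume "nonsingular_on I A"
    then obtain B where "\<forall>i\<in>I. \<forall>j\<in>I. (\<Sum>k\<in>I. A i k * B k j) = (if i = j then 1 else 0)"
      "\<forall>i\<in>I. \<forall>j\<in>I. (\<Sum>k\<in>I. B i k * A k j) = (if i = j then 1 else 0)"
      unfolding nonsingular_on_def by blast
    then have "padded I A ** padded I B = mat 1" "padded I B ** padded I A = mat 1"
      by (auto intro: inv)
    then have "invertible (padded I A)" unfolding invertible_def by blast
    then show "det (padded I A) \<noteq> 0" by (simp add: invertible_det_nz)
  next
    assume "det (padded I A) \<noteq> 0"
    then obtain B where B: "padded I A ** B = mat 1" "B ** padded I A = mat 1"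
      unfolding invertible_det_nz[symmetric] invertible_def by blast
    have "(\<Sum>k\<in>I. A i k * B $ k $ j) = (if i = j then 1 else 0)" if "i \<in> I" for i j
      using arg_cong[OF B(1), of "\<lambda>M. M $ i $ j"] that by (simp add: matrix_matrix_mult_def row mat_def)
    moreover have "(\<Sum>k\<in>I. B $ i $ k * A k j) = (if i = j then 1 else 0)" if "j \<in> I" for i j
      using arg_cong[OF B(2), of "\<lambda>M. M $ i $ j"] that by (simp add: matrix_matrix_mult_def col mat_def)
    ultimately show "nonsingular_on I A"
      unfolding nonsingular_on_def by (intro exI[of _ "\<lambda>i j. B $ i $ j"]) auto
  qed
qed

text \<open>The kernel is taken on the left because the sum of v_k times the k-th partial of a
  function \<open>partial j g\<close> is its derivative in direction v.\<close>

lemma singular_on_left_kernel: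
  fixes A :: "'n::finite \<Rightarrow> 'n \<Rightarrow> real"
  assumes "\<not> nonsingular_on I A"
  obtains v :: "real^'n" where "v \<noteq> 0" "\<And>i. i \<notin> I \<Longrightarrow> v $ i = 0"
    "\<And>j. j \<in> I \<Longrightarrow> (\<Sum>i\<in>UNIV. v $ i * A i j) = 0"
proof -
  have "det (transpose (padded I A)) = 0"
    using assms by (simp add: nonsingular_on_iff_det det_transpose)
  then have "\<not> (\<exists>B. B ** transpose (padded I A) = mat 1)"
    using invertible_det_nz invertible_left_inverse by blast
  then obtain v where v: "transpose (padded I A) *v v = 0" "v \<noteq> 0"
    unfolding matrix_left_invertible_ker by blast
  have eq: "(\<Sum>i\<in>UNIV. padded I A $ i $ j * v $ i) = 0" for j
    using arg_cong[OF v(1), of "\<lambda>w. w $ j"] by (simp add: matrix_vector_mult_def transpose_def)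
  \<comment> \<open>For j outside I the j-th column of the padded matrix is a unit vector, so the
    equation itself says v_j = 0.\<close>
  have off: "v $ j = 0" if "j \<notin> I" for j
    using eq[of j] that by (simp add: padded_def if_distrib[of "\<lambda>u. u * _"] cong: if_cong)
  moreover have "(\<Sum>i\<in>UNIV. v $ i * A i j) = 0" if "j \<in> I" for j
  proof -
    have "(\<Sum>i\<in>UNIV. v $ i * A i j) = (\<Sum>i\<in>UNIV. padded I A $ i $ j * v $ i)"
      by (rule sum.cong) (use that off in \<open>auto simp: padded_def\<close>)
    then show ?thesis using eq by simp
  qed
  ultimately show thesis using that v(2) by blast
qed

text \<open>Enlarging the support to \<open>J\<close> turns degeneracy into a condition that is closed in \<open>x\<close> and in the
  derivatives: a limit of nonzero entries may vanish, but then (ND1) fails in the limit.\<close>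

lemma degenerate_M_stationary_iff:
  fixes x :: "real^'n::finite"
  shows "M_stationary s f x \<and> \<not> nondegenerate s f x \<longleftrightarrow>
    (\<exists>J. card J \<le> s \<and> (\<forall>i. i \<notin> J \<longrightarrow> x $ i = 0) \<and> (\<forall>j\<in>J. partial j f x = 0) \<and>
      ((\<exists>j\<in>J. x $ j = 0) \<or> \<not> nonsingular_on J (\<lambda>i j. partial i (partial j f) x)))"
    (is "?L \<longleftrightarrow> (\<exists>J. ?R J)")
proof
  assume L: ?L
  show "\<exists>J. ?R J"
  \<comment> \<open>If (ND1) fails at j, the support has room for j and J is the support with j
    added. Otherwise (ND2) fails and J is the support.\<close>
  proof (cases "\<exists>j\<in>I0 x. norm0 x < s \<and> partial j f x = 0")
    case True
    then obtain j where j: "x $ j = 0" "norm0 x < s" "partial j f x = 0" by (auto simp: I0_def)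
    have "card (insert j (I1 x)) \<le> s"
      using j by (simp add: I1_def norm0_def card_insert_if)
    then show ?thesis
      using L j by (intro exI[of _ "insert j (I1 x)"]) (auto simp: M_stationary_def I1_def)
  next
    case False
    then show ?thesis
      using L by (intro exI[of _ "I1 x"])
        (auto simp: M_stationary_def nondegenerate_def sparse_vectors_def norm0_def I1_def)
  qed
next
  assume "\<exists>J. ?R J"
  then obtain J where J: "?R J" by blast
  then have sub: "I1 x \<subseteq> J" by (auto simp: I1_def)
  then have card: "norm0 x \<le> card J" by (simp add: norm0_def I1_def card_mono)
  have M: "M_stationary s f x" using J sub card by (auto simp: M_stationary_def sparse_vectors_def)
  moreover have "\<not> nondegenerate s f x"
  proof (cases "\<exists>j\<in>J. x $ j = 0")
    case True
    then obtain j where j: "j \<in> J" "x $ j = 0" by blast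
    \<comment> \<open>A zero entry within J makes the support strictly smaller than J, hence smaller
      than s, so (ND1) applies and j violates it.\<close>
    then have "I1 x \<subset> J" using sub by (auto simp: I1_def)
    then have "card (I1 x) < card J" by (simp add: psubset_card_mono)
    then have "norm0 x < s" using J by (simp add: norm0_def I1_def)
    then show ?thesis using j J by (auto simp: nondegenerate_def I0_def)
  next
    case False
    then have "I1 x = J" using sub by (auto simp: I1_def)
    then show ?thesis using J False by (auto simp: nondegenerate_def)
  qed
  ultimately show ?L by blast
qed

text \<open>The base point belongs to the jet because degeneracy depends on its zero pattern; the
  function value does not enter degeneracy and is left out.\<close>

definition jet :: "(real^'n::finite \<Rightarrow> real) \<Rightarrow> real^'n \<Rightarrow> (real^'n) \<times> (real^'n) \<times> (real^'n^'n)" where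
  "jet f x = (x, \<chi> i. partial i f x, \<chi> i j. partial i (partial j f) x)"

definition degenerate_jets :: "nat \<Rightarrow> ((real^'n::finite) \<times> (real^'n) \<times> (real^'n^'n)) set" where
  "degenerate_jets s = {(x, p, H). \<exists>J. card J \<le> s \<and> (\<forall>i\<in>-J. x $ i = 0) \<and> (\<forall>j\<in>J. p $ j = 0) \<and>
     ((\<exists>j\<in>J. x $ j = 0) \<or> det (padded J (\<lambda>i j. H $ i $ j)) = 0)}"

lemma nondegenerate_objectives_iff_jet:
  "f \<in> nondegenerate_objectives s \<longleftrightarrow> f \<in> C2 \<and> (\<forall>x. jet f x \<notin> degenerate_jets s)"
proof -
  have "jet f x \<in> degenerate_jets s \<longleftrightarrow> M_stationary s f x \<and> \<not> nondegenerate s f x" for x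
    unfolding degenerate_M_stationary_iff by (simp add: jet_def degenerate_jets_def nonsingular_on_iff_det vec_lambda_inverse Ball_def)
  then show ?thesis by (auto simp: nondegenerate_objectives_def)
qed

text \<open>Only equations between continuous functions occur, with no inequation on the entries of
  x, and they are combined by intersections and by unions over finite index sets.\<close>

lemma closed_degenerate_jets: "closed (degenerate_jets s :: ((real^'n::finite) \<times> (real^'n) \<times> (real^'n^'n)) set)"
proof -
  define K where "K J = (\<Inter>i\<in>-J. {z. fst z $ i = 0}) \<inter> (\<Inter>j\<in>J. {z. fst (snd z) $ j = 0}) \<inter>
      ((\<Union>j\<in>J. {z. fst z $ j = 0}) \<union>
       {z :: (real^'n) \<times> (real^'n) \<times> (real^'n^'n). det (padded J (\<lambda>i j. snd (snd z) $ i $ j)) = 0})" for J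
  have "continuous_on UNIV (\<lambda>z :: (real^'n) \<times> (real^'n) \<times> (real^'n^'n).
      (padded J (\<lambda>i j. snd (snd z) $ i $ j) $ i $ j))" for J i j
    by (cases "i \<in> J \<and> j \<in> J") (auto simp: padded_def intro!: continuous_intros)
  then have "continuous_on UNIV (\<lambda>z :: (real^'n) \<times> (real^'n) \<times> (real^'n^'n).
      det (padded J (\<lambda>i j. snd (snd z) $ i $ j)))" for J
    unfolding det_def by (intro continuous_on_sum continuous_on_mult continuous_on_const continuous_on_prod)
  then have "closed (K J)" for J
    unfolding K_def
    by (intro closed_Int closed_INT closed_Un closed_UN closed_Collect_eq ballI finite continuous_intros)
  moreover have "z \<in> degenerate_jets s \<longleftrightarrow> (\<exists>J. card J \<le> s \<and> z \<in> K J)" for z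
    by (cases z) (simp add: degenerate_jets_def K_def conj_assoc)
  then have "degenerate_jets s = (\<Union>J\<in>{J. card J \<le> s}. K J)" by auto
  ultimately show ?thesis by (auto intro!: closed_UN)
qed

lemma openin_nondegenerate_objectives:
  "openin C2s_topology (nondegenerate_objectives s :: (real^'n::finite \<Rightarrow> real) set)"
  unfolding openin_C2s
proof (intro conjI ballI)
  show "nondegenerate_objectives s \<subseteq> (C2 :: (real^'n \<Rightarrow> real) set)"
    by (auto simp: nondegenerate_objectives_def)
  fix f :: "real^'n \<Rightarrow> real" assume f: "f \<in> nondegenerate_objectives s"
  then have fC: "f \<in> C2" and fB: "\<And>x. jet f x \<notin> degenerate_jets s"
    by (auto simp: nondegenerate_objectives_iff_jet)
  show "\<exists>\<epsilon>. continuous_on UNIV \<epsilon> \<and> (\<forall>x. 0 < \<epsilon> x) \<and> C2_nbhd f \<epsilon> \<subseteq> nondegenerate_objectives s"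
  proof (cases "degenerate_jets s = ({} :: ((real^'n) \<times> (real^'n) \<times> (real^'n^'n)) set)")
    \<comment> \<open>\<open>infdist\<close> to the empty set is 0 by convention, so this case,
      which occurs for s = 0, cannot use it as a radius.\<close>
    case True
    then have "C2_nbhd f (\<lambda>_. 1) \<subseteq> nondegenerate_objectives s"
      by (auto simp: nondegenerate_objectives_iff_jet C2_nbhd_def)
    then show ?thesis by (intro exI[of _ "\<lambda>_. 1"]) auto
  next
    case False
    \<comment> \<open>The gradient difference contributes at most CARD('n) and the Hessian
      difference at most its square, in units of \<epsilon> x; the additional 1 yields the strict
      contradiction.\<close>
    define N where "N = 1 + real CARD('n) + real CARD('n) * real CARD('n)"
    have N: "N > 0" by (simp add: N_def add_pos_nonneg)
    define \<epsilon> where "\<epsilon> x = infdist (jet f x) (degenerate_jets s) / N" for x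
    have "continuous_on UNIV (jet f)"
      unfolding jet_def using fC by (auto simp: C2_def intro!: continuous_intros)
    then have "continuous_on UNIV \<epsilon>"
      unfolding \<epsilon>_def using N by (auto intro!: continuous_intros)
    moreover have pos: "0 < \<epsilon> x" for x
    proof -
      have "infdist (jet f x) (degenerate_jets s) \<noteq> 0"
        using fB[of x] in_closed_iff_infdist_zero[OF closed_degenerate_jets False] by blast
      then show ?thesis using N infdist_nonneg[of "jet f x" "degenerate_jets s"] by (simp add: \<epsilon>_def)
    qed
    moreover have "C2_nbhd f \<epsilon> \<subseteq> nondegenerate_objectives s"
    proof
      fix g assume g: "g \<in> C2_nbhd f \<epsilon>"
      then have gC: "g \<in> C2" by (simp add: C2_nbhd_def)
      have "jet g x \<notin> degenerate_jets s" for x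
      proof
        assume "jet g x \<in> degenerate_jets s"
        then have "N * \<epsilon> x \<le> dist (jet f x) (jet g x)"
          using N infdist_le[of "jet g x" "degenerate_jets s" "jet f x"] by (simp add: \<epsilon>_def)
        also have "\<dots> = norm (jet g x - jet f x)" by (simp add: dist_norm norm_minus_commute)
        also have "\<dots> \<le> norm (\<chi> i. partial i g x - partial i f x) +
            norm (\<chi> i j. partial i (partial j g) x - partial i (partial j f) x)"
        proof -
          have "jet g x - jet f x = (0, (\<chi> i. partial i g x - partial i f x),
              \<chi> i j. partial i (partial j g) x - partial i (partial j f) x)"
            by (simp add: jet_def vec_eq_iff)
          then show ?thesis using sqrt_sum_squares_le_sum[OF norm_ge_zero norm_ge_zero] by (simp add: norm_Pair)
        qed
        also have "norm (\<chi> i. partial i g x - partial i f x) \<le> real CARD('n) * \<epsilon> x"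
        proof -
          have "norm (\<chi> i. partial i g x - partial i f x) \<le> (\<Sum>i\<in>UNIV. \<bar>partial i g x - partial i f x\<bar>)"
            using norm_le_l1_cart[of "\<chi> i. partial i g x - partial i f x"] by simp
          also have "\<dots> \<le> (\<Sum>i\<in>(UNIV :: 'n set). \<epsilon> x)"
            using g by (intro sum_mono) (auto simp: C2_nbhd_def C2_diff_partials[OF gC fC] less_imp_le)
          finally show ?thesis by simp
        qed
        also have "norm (\<chi> i j. partial i (partial j g) x - partial i (partial j f) x) \<le>
            real CARD('n) * real CARD('n) * \<epsilon> x"
        proof -
          let ?M = "\<chi> i j. partial i (partial j g) x - partial i (partial j f) x"
          have "norm ?M \<le> (\<Sum>i\<in>UNIV. norm (?M $ i))"
            unfolding norm_vec_def by (rule L2_set_le_sum) simp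
          also have "\<dots> \<le> (\<Sum>i\<in>(UNIV::'n set). \<Sum>j\<in>(UNIV::'n set). \<epsilon> x)"
          proof (rule sum_mono)
            fix i :: 'n
            have "norm (?M $ i) \<le> (\<Sum>j\<in>UNIV. \<bar>?M $ i $ j\<bar>)" by (rule norm_le_l1_cart)
            also have "\<dots> \<le> (\<Sum>j\<in>(UNIV::'n set). \<epsilon> x)"
              using g by (intro sum_mono) (auto simp: C2_nbhd_def C2_diff_partials[OF gC fC] less_imp_le)
            finally show "norm (?M $ i) \<le> (\<Sum>j\<in>(UNIV::'n set). \<epsilon> x)" .
          qed
          finally show ?thesis by simp
        qed
        finally show False using pos[of x] by (simp add: N_def distrib_right)
      qed
      then show "g \<in> nondegenerate_objectives s" using gC by (simp add: nondegenerate_objectives_iff_jet)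
    qed
    ultimately show ?thesis by blast
  qed
qed

section \<open>Density\<close>

lemma has_derivative_vec_lambda:
  fixes f f' :: "'n::finite \<Rightarrow> 'a::real_normed_vector \<Rightarrow> real"
  assumes "\<And>i. (f i has_derivative f' i) (at x within S)"
  shows "((\<lambda>y. \<chi> i. f i y) has_derivative (\<lambda>v. \<chi> i. f' i v)) (at x within S)"
  using assms
  by (subst has_derivative_componentwise_within)
     (auto simp: Basis_vec_def inner_axis)

text \<open>A parameter \<open>(c, d)\<close> that is bad for the support \<open>J\<close> at the point \<open>x\<close> can be recovered from
  \<open>x\<close> and the value \<open>l = c \<bullet> x + d\<close>: solving the stationarity equations for \<open>c\<close> gives
  \<open>(c, d) = \<Psi> (x, l)\<close>, where the coordinates outside \<open>J\<close> carry the free components of \<open>c\<close>.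
  If \<open>v\<close> is in the kernel of the Hessian, then \<open>(v, c \<bullet> v)\<close> is in the kernel of the derivative of
  \<open>\<Psi>\<close>, so that Sard's theorem applies.\<close>

lemma negligible_degenerate_parameters:
  fixes f \<phi> :: "real^'n::finite \<Rightarrow> real" and J :: "'n set"
  assumes f: "f \<in> C2" and \<phi>: "\<phi> \<in> C2" and pos: "\<And>x. 0 < \<phi> x"
  defines "g \<equiv> \<lambda>c d x. f x + \<phi> x * (c \<bullet> x + d)"
  shows "negligible {(c, d). \<exists>x. (\<forall>i. i \<notin> J \<longrightarrow> x $ i = 0) \<and> (\<forall>j\<in>J. partial j (g c d) x = 0) \<and>
      ((\<exists>j\<in>J. x $ j = 0) \<or> \<not> nonsingular_on J (\<lambda>i j. partial i (partial j (g c d)) x))}"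
    (is "negligible ?B")
proof -
  define P where "P x = (\<chi> i. if i \<in> J then x $ i else 0)" for x :: "real^'n"
  have "linear P" by (rule linearI) (auto simp: P_def vec_eq_iff)
  then have P: "(P has_derivative P) F" for F
    by (simp add: linear_imp_has_derivative)
  \<comment> \<open>Stationarity at index i reads N i + \<phi> * c_i = 0 with l as second component
    of z, so c_i is the negative quotient in \<open>C\<close>.\<close>
  define N where "N i z = partial i f (P (fst z)) + snd z * partial i \<phi> (P (fst z))"
    for i and z :: "(real^'n) \<times> real"
  define D where "D F x w = (\<Sum>k\<in>UNIV. P (fst w) $ k * partial k F (P x))"
    for F :: "real^'n \<Rightarrow> real" and x and w :: "(real^'n) \<times> real"
  define N' where "N' i z w = D (partial i f) (fst z) w +
      (snd z * D (partial i \<phi>) (fst z) w + snd w * partial i \<phi> (P (fst z)))"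
    for i and z w :: "(real^'n) \<times> real"
  define C where "C z = (\<chi> i. if i \<in> J then - (N i z / \<phi> (P (fst z))) else fst z $ i)" for z
  define C' where "C' z w = (\<chi> i. if i \<in> J
      then - ((N' i z w * \<phi> (P (fst z)) - N i z * D \<phi> (fst z) w) / (\<phi> (P (fst z)) * \<phi> (P (fst z)))) else fst w $ i)" for z w
  define \<Psi> where "\<Psi> z = (C z, snd z - C z \<bullet> P (fst z))" for z
  define \<Psi>' where "\<Psi>' z w = (C' z w, snd w - (C z \<bullet> P (fst w) + C' z w \<bullet> P (fst z)))" for z w
  have Pfst: "((\<lambda>z. P (fst z)) has_derivative (\<lambda>w. P (fst w))) (at z)" for z :: "(real^'n) \<times> real"
    by (rule has_derivative_compose[OF has_derivative_fst[OF has_derivative_ident] P])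
  have D: "((\<lambda>z. F (P (fst z))) has_derivative D F (fst z)) (at z)"
    if "\<And>x. (F has_derivative (\<lambda>v. \<Sum>k\<in>UNIV. v $ k * partial k F x)) (at x)" for F z
    unfolding D_def by (rule has_derivative_compose[OF Pfst that])
  have N: "(N i has_derivative N' i z) (at z)" for i z
    unfolding N_def N'_def
    by (intro has_derivative_add has_derivative_mult D C2_partial_has_derivative f \<phi>
        has_derivative_snd has_derivative_ident)
  have C: "(C has_derivative C' z) (at z)" for z
    unfolding C_def C'_def
  proof (rule has_derivative_vec_lambda)
    fix i
    show "((\<lambda>z. if i \<in> J then - (N i z / \<phi> (P (fst z))) else fst z $ i) has_derivative
       (\<lambda>w. if i \<in> J then - ((N' i z w * \<phi> (P (fst z)) - N i z * D \<phi> (fst z) w) /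
         (\<phi> (P (fst z)) * \<phi> (P (fst z)))) else fst w $ i)) (at z)"
    proof (cases "i \<in> J")
      case True
      have "\<phi> (P (fst z)) \<noteq> 0" using pos less_irrefl by metis
      then show ?thesis
        using has_derivative_minus[OF has_derivative_divide'[OF N D[OF C2_has_derivative[OF \<phi>]]]] True by simp
    next
      case False
      then show ?thesis
        by (simp add: bounded_linear_imp_has_derivative bounded_linear_compose[OF bounded_linear_vec_nth bounded_linear_fst])
    qed
  qed
  have \<Psi>: "(\<Psi> has_derivative \<Psi>' z) (at z)" for z
    unfolding \<Psi>_def \<Psi>'_def
    by (intro has_derivative_Pair has_derivative_diff has_derivative_inner C Pfst has_derivative_snd has_derivative_ident)
  define S1 where "S1 = {z. \<exists>w. w \<noteq> 0 \<and> \<Psi>' z w = 0}"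
  \<comment> \<open>These hyperplanes take care of the alternative that x vanishes at some index of
    J.\<close>
  define S2 where "S2 = (\<Union>j\<in>J. {z :: (real^'n) \<times> real. (axis j 1, 0) \<bullet> z = 0})"
  have "negligible (\<Psi> ` S1)"
    by (rule Sard_euclidean[where f' = \<Psi>']) (auto simp: S1_def intro: has_derivative_at_withinI \<Psi>)
  moreover have "negligible (\<Psi> ` S2)"
  proof (rule negligible_differentiable_image_negligible)
    show "negligible S2"
      unfolding S2_def
      by (rule negligible_Union) (auto intro!: negligible_hyperplane simp: axis_eq_0_iff zero_prod_def)
    show "\<Psi> differentiable_on S2"
      unfolding differentiable_on_def differentiable_def using \<Psi> has_derivative_at_withinI by blast
  qed simp
  moreover have "?B \<subseteq> \<Psi> ` S1 \<union> \<Psi> ` S2"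
  proof clarify
    fix c d x
    assume off: "\<forall>i. i \<notin> J \<longrightarrow> x $ i = 0" and stat: "\<forall>j\<in>J. partial j (g c d) x = 0"
      and deg: "(\<exists>j\<in>J. x $ j = 0) \<or> \<not> nonsingular_on J (\<lambda>i j. partial i (partial j (g c d)) x)"
      and not2: "(c, d) \<notin> \<Psi> ` S2"
    define l where "l = c \<bullet> x + d"
    define z where "z = ((\<chi> i. if i \<in> J then x $ i else c $ i), l)"
    have Pz: "P (fst z) = x" using off by (auto simp: z_def P_def vec_eq_iff)
    have pg: "partial i (g c d) x = partial i f x + (partial i \<phi> x * l + \<phi> x * c $ i)" for i
      unfolding g_def l_def
      by (simp add: partial_add[OF f C2_mult_affine[OF \<phi>]] partial_mult_affine[OF \<phi>])
    have ppg: "partial k (partial i (g c d)) x = partial k (partial i f) x +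
        (partial k (partial i \<phi>) x * l + partial i \<phi> x * c $ k + partial k \<phi> x * c $ i)" for i k
      unfolding g_def l_def
      by (simp add: partial_partial_add[OF f C2_mult_affine[OF \<phi>]] partial_partial_mult_affine[OF \<phi>])
    have Nz: "N i z = - (\<phi> x * c $ i)" if "i \<in> J" for i
      using stat pg[of i] that by (simp add: N_def Pz) (simp add: z_def mult.commute)
    have Cz: "C z = c"
      using pos[of x] by (auto simp: C_def vec_eq_iff Nz Pz) (simp add: z_def)
    have \<Psi>z: "\<Psi> z = (c, d)" by (simp add: \<Psi>_def Cz Pz) (simp add: z_def l_def)
    have "\<not> nonsingular_on J (\<lambda>i j. partial i (partial j (g c d)) x)"
    proof -
      have "z \<notin> S2" using not2 \<Psi>z by (metis image_eqI)
      then have "\<forall>j\<in>J. x $ j \<noteq> 0" by (auto simp: S2_def z_def inner_axis')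
      then show ?thesis using deg by blast
    qed
    then obtain v :: "real^'n" where v: "v \<noteq> 0" "\<And>i. i \<notin> J \<Longrightarrow> v $ i = 0"
      "\<And>j. j \<in> J \<Longrightarrow> (\<Sum>k\<in>UNIV. v $ k * partial k (partial j (g c d)) x) = 0"
      by (rule singular_on_left_kernel) blast
    define w where "w = (v, c \<bullet> v)"
    have Pw: "P (fst w) = v" using v(2) by (auto simp: w_def P_def vec_eq_iff)
    \<comment> \<open>Along w the value l varies at the rate c . v, as c . x + d does for fixed c.
      The left side plus c_i times the derivative of \<phi> is thus the derivative of
      \<open>partial i (g c d)\<close> along v, which is zero.\<close>
    have N'z: "N' i z w = - (c $ i * D \<phi> (fst z) w)" if "i \<in> J" for i
    proof -
      have "N' i z w + c $ i * D \<phi> (fst z) w = (\<Sum>k\<in>UNIV. v $ k * partial k (partial i (g c d)) x)"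
        unfolding ppg by (simp add: N'_def D_def Pw Pz)
          (simp add: z_def w_def inner_vec_def sum_distrib_left sum_distrib_right sum.distrib algebra_simps)
      then show ?thesis using v(3)[OF that] by simp
    qed
    \<comment> \<open>By \<open>Nz\<close> and \<open>N'z\<close> the two terms in the numerator of
      the quotient rule cancel.\<close>
    have "C' z w = 0"
      using v(2) by (auto simp: C'_def vec_eq_iff Nz N'z Pz) (simp add: w_def)
    then have "\<Psi>' z w = 0" by (simp add: \<Psi>'_def Cz Pw) (simp add: w_def zero_prod_def)
    moreover have "w \<noteq> 0" using v(1) by (simp add: w_def zero_prod_def)
    ultimately have "z \<in> S1" unfolding S1_def by blast
    then show "(c, d) \<in> \<Psi> ` S1" using \<Psi>z by (metis image_eqI)
  qed
  ultimately show ?thesis by (meson negligible_Un negligible_subset)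
qed

lemma nondegenerate_objectives_dense:
  fixes f :: "real^'n::finite \<Rightarrow> real"
  assumes f: "f \<in> C2" and cont: "continuous_on UNIV \<epsilon>" and pos: "\<And>x. 0 < \<epsilon> x"
  shows "\<exists>g \<in> nondegenerate_objectives s. g \<in> C2_nbhd f \<epsilon>"
proof -
  \<comment> \<open>For parameters in the unit ball the affine factor is at most norm x + 1, and the
    product rule adds at most two terms bounded by \<eta> x. The total norm x + 3 stays strictly
    below norm x + 4.\<close>
  define \<eta> where "\<eta> x = \<epsilon> x / (norm x + 4)" for x
  have den: "0 < norm x + 4" for x :: "real^'n" by (simp add: add_nonneg_pos)
  have "continuous_on UNIV \<eta>"
    unfolding \<eta>_def using den by (intro continuous_intros cont) (metis less_irrefl)
  moreover have \<eta>: "0 < \<eta> x" for x using pos den by (simp add: \<eta>_def)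
  ultimately obtain \<phi> where \<phi>: "\<phi> \<in> C2" "\<And>x. 0 < \<phi> x" and le: "\<And>x. \<bar>\<phi> x\<bar> \<le> \<eta> x"
    "\<And>i x. \<bar>partial i \<phi> x\<bar> \<le> \<eta> x" "\<And>i j x. \<bar>partial i (partial j \<phi>) x\<bar> \<le> \<eta> x"
    by (rule exists_small_C2) blast
  define g where "g c d x = f x + \<phi> x * (c \<bullet> x + d)" for c d x
  define B where "B J = {(c, d). \<exists>x. (\<forall>i. i \<notin> J \<longrightarrow> x $ i = 0) \<and> (\<forall>j\<in>J. partial j (g c d) x = 0) \<and>
      ((\<exists>j\<in>J. x $ j = 0) \<or> \<not> nonsingular_on J (\<lambda>i j. partial i (partial j (g c d)) x))}" for J
  have "negligible (B J)" for J
    unfolding B_def g_def by (rule negligible_degenerate_parameters[OF f \<phi>])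
  then have "negligible (\<Union>J\<in>UNIV. B J)"
    by (intro negligible_Union) auto
  moreover have "\<not> negligible (ball 0 1 :: ((real^'n) \<times> real) set)"
    by (intro open_not_negligible) auto
  \<comment> \<open>One parameter avoids the bad sets of all supports J simultaneously, since their
    union is null and the ball is not.\<close>
  ultimately have "\<not> ball 0 1 \<subseteq> (\<Union>J\<in>UNIV. B J)"
    using negligible_subset by blast
  then obtain c d where cd: "(c, d) \<in> ball 0 1" "\<And>J. (c, d) \<notin> B J"
    unfolding subset_iff by (auto simp del: mem_ball)
  have gC: "g c d \<in> C2"
    unfolding g_def by (intro C2_add f C2_mult_affine \<phi>)
  have "\<not> (M_stationary s (g c d) x \<and> \<not> nondegenerate s (g c d) x)" for x
    unfolding degenerate_M_stationary_iff using cd(2) by (auto simp: B_def)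
  then have "g c d \<in> nondegenerate_objectives s" using gC by (auto simp: nondegenerate_objectives_def)
  moreover have "g c d \<in> C2_nbhd f \<epsilon>"
  proof -
    have c: "norm c \<le> 1" and d: "\<bar>d\<bar> \<le> 1"
      using cd(1) norm_fst_le[of c d] norm_snd_le[of d c] by auto
    have ci: "\<bar>c $ i\<bar> \<le> 1" for i using component_le_norm_cart[of c i] c by linarith
    have aff: "\<bar>c \<bullet> x + d\<bar> \<le> norm x + 1" for x
    proof -
      have "\<bar>c \<bullet> x\<bar> \<le> norm c * norm x" by (rule Cauchy_Schwarz_ineq2)
      also have "\<dots> \<le> norm x" using c by (simp add: mult_left_le_one_le)
      finally show ?thesis using d by linarith
    qed
    have lt: "\<eta> x * (norm x + 1) + \<eta> x + \<eta> x < \<epsilon> x" for x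
    proof -
      have "\<epsilon> x = \<eta> x * (norm x + 4)" using den[of x] by (simp add: \<eta>_def)
      then show ?thesis using \<eta>[of x] by (simp add: distrib_left)
    qed
    have b: "\<bar>a * (c \<bullet> x + d)\<bar> \<le> \<eta> x * (norm x + 1)" if "\<bar>a\<bar> \<le> \<eta> x" for a x
      unfolding abs_mult by (intro mult_mono that aff) (use \<eta>[of x] in auto)
    have b1: "\<bar>a * c $ i\<bar> \<le> \<eta> x" if "\<bar>a\<bar> \<le> \<eta> x" for a x i
      using mult_mono[OF that ci[of i]] \<eta>[of x] by (simp add: abs_mult)
    have diff: "(\<lambda>y. g c d y - f y) = (\<lambda>y. \<phi> y * (c \<bullet> y + d))" by (simp add: g_def)
    have "\<bar>g c d x - f x\<bar> < \<epsilon> x" for x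
      using b[OF le(1)[of x]] lt[of x] \<eta>[of x] by (simp add: g_def)
    moreover have "\<bar>partial i (\<lambda>y. g c d y - f y) x\<bar> < \<epsilon> x" for i x
      unfolding diff partial_mult_affine[OF \<phi>(1)]
      using b[OF le(2)[of i x]] b1[OF le(1)[of x], of i] lt[of x] \<eta>[of x] by linarith
    moreover have "\<bar>partial j (partial i (\<lambda>y. g c d y - f y)) x\<bar> < \<epsilon> x" for i j x
      unfolding diff partial_partial_mult_affine[OF \<phi>(1)]
      using b[OF le(3)[of j i x]] b1[OF le(2)[of i x], of j] b1[OF le(2)[of j x], of i] lt[of x] by linarith
    ultimately show ?thesis using gC by (simp add: C2_nbhd_def)
  qed
  ultimately show ?thesis by blast
qed

theorem theorem2:
  fixes s :: nat
  assumes "s < CARD('n::finite)"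
  shows "openin C2s_topology (nondegenerate_objectives s :: (real^'n \<Rightarrow> real) set) \<and>
         C2s_topology closure_of (nondegenerate_objectives s :: (real^'n \<Rightarrow> real) set) = C2"
proof
  show "openin C2s_topology (nondegenerate_objectives s :: (real^'n \<Rightarrow> real) set)"
    by (rule openin_nondegenerate_objectives)
  have "f \<in> C2s_topology closure_of nondegenerate_objectives s" if "f \<in> C2" for f :: "real^'n \<Rightarrow> real"
    unfolding in_closure_of topspace_C2s
  proof (intro conjI allI impI that)
    fix T assume "f \<in> T \<and> openin C2s_topology T"
    then obtain \<epsilon> where "continuous_on UNIV \<epsilon>" "\<forall>x. 0 < \<epsilon> x" "C2_nbhd f \<epsilon> \<subseteq> T"
      unfolding openin_C2s by blast
    then show "\<exists>g. g \<in> nondegenerate_objectives s \<and> g \<in> T"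
      using nondegenerate_objectives_dense[OF that, of \<epsilon> s] by blast
  qed
  then show "C2s_topology closure_of (nondegenerate_objectives s :: (real^'n \<Rightarrow> real) set) = C2"
    using closure_of_subset_topspace[of C2s_topology] unfolding topspace_C2s by blast
qed

end
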